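(* Let $p$ be a prime, $n\ge 1$, $H\le\mathcal{H}(p^n)$, $S$ a special generating set for $H$, and $I$ an injective set for $S$. (1) If $|I|=0$, then $|P(H)|=|C(H)|$. (2) If $|I|=1$, then $|P(H)|=p\,|C(H)|$. (3) If $|I|=2$, then $|P(H)|=p^2\,|C(H)|$.
   Context: For an integer $r\ge 1$, $\mathcal{H}(r)$ denotes the Heisenberg group of $3\times3$ upper unitriangular matrices over $\mathbb{Z}_r=\mathbb{Z}/r\mathbb{Z}$ (trivial if $r=1$). The matrix with $(1,2)$-entry $a_1$, $(1,3)$-entry $a_2$, $(2,3)$-entry $a_3$ is written $(a_1,a_2,a_3)$, so $(a_1,a_2,a_3)(b_1,b_2,b_3)=(a_1+b_1,\,a_2+b_2+a_1b_3,\,a_3+b_3)$; the center of $\mathcal{H}(r)$ is $\{(0,x,0)\}$. Let $q:\mathcal{H}(p^n)\to\mathcal{H}(p^{n-1})$ be the surjective homomorphism reducing each component mod $p^{n-1}$. With $[x,y]=x^{-1}y^{-1}xy$, for a non-empty $S\subseteq \mathcal{H}(p^n)$ the pseudocentralizer is $P(S)=\{g : [s,g]\in\ker q \text{ for all } s\in S\}$, and $C(S)$ is the centralizer of $S$ in $\mathcal{H}(p^n)$. Write $x\sim y$ if $xy^{-1}\in Z(\mathcal{H}(p^n))$, and $S^{\dagger}=S\setminus Z(\mathcal{H}(p^n))$. For an element $h_j\in\mathcal{H}(p^n)$ let $k_{j1},k_{j3}$ be the $p$-adic valuations of its first and third components (with components viewed as integers in $\{0,\dots,p^n-1\}$), where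 the valuation of the component $0$ is taken to be $n$. Put $\nu(h_j)=\min\{k_{j1},k_{j3}\}$, $\nu(h_1,\dots,h_m)=\nu(\{h_1,\dots,h_m\})=\min_j\nu(h_j)$, and for distinct $h_s,h_t$, $\mu(h_s,h_t)=\min\{k_{s3}+k_{t1},\,k_{s1}+k_{t3}\}-\nu(h_s,h_t)$. A generating set $S$ for $H\le\mathcal{H}(p^n)$ is special if either $S^\dagger=\emptyset$, or there is $h_1\in S^\dagger$ with $\nu(S^\dagger)=\nu(h_1)$ and $h_2\not\sim h_1^w$ for all $h_2\in S^\dagger\setminus\{h_1\}$ and all integers $w\ge 0$. An injective set for a special generating set $S$ is a subset $I\subseteq S^\dagger$ of maximal cardinality among those satisfying: (1) $|I|\le 2$; (2) if $|S^\dagger|>0$, then $\nu(I)=\nu(S^\dagger)=\nu(h_1)$ for some $h_1\in S^{\dagger}$ (lying in $I$); (3) if $I=\{h_1,h_2\}$, with $h_1$ as in (2), then $\mu(h_1,h_2)\le\mu(h_1,h_j)$ for all $h_j\in S^\dagger\setminus\{h_1\}$. *)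

theory Defs
  imports
    "HOL-Algebra.Generated_Groups"
    "HOL-Computational_Algebra.Primes"
begin

section \<open>Notions for arbitrary groups\<close>

definition group_center :: "('a, 'b) monoid_scheme \<Rightarrow> 'a set" where
  "group_center G = {z \<in> carrier G. \<forall>g \<in> carrier G. z \<otimes>\<^bsub>G\<^esub> g = g \<otimes>\<^bsub>G\<^esub> z}"

definition group_centralizer :: "('a, 'b) monoid_scheme \<Rightarrow> 'a set \<Rightarrow> 'a set" where
  "group_centralizer G S = {g \<in> carrier G. \<forall>s \<in> S. s \<otimes>\<^bsub>G\<^esub> g = g \<otimes>\<^bsub>G\<^esub> s}"

definition group_commutator :: "('a, 'b) monoid_scheme \<Rightarrow> 'a \<Rightarrow> 'a \<Rightarrow> 'a" where
  "group_commutator G x y = inv\<^bsub>G\<^esub> x \<otimes>\<^bsub>G\<^esub> inv\<^bsub>G\<^esub> y \<otimes>\<^bsub>G\<^esub> x \<otimes>\<^bsub>G\<^esub> y"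

section \<open>Heisenberg groups\<close>

type_synonym heis = "int \<times> int \<times> int"

text \<open>
  The triple \<open>(a1, a2, a3)\<close> of canonical residues modulo \<open>r\<close> stands for the upper unitriangular
  matrix with (1,2)-entry \<open>a1\<close>, (1,3)-entry \<open>a2\<close> and (2,3)-entry \<open>a3\<close>; see
  \<open>heis_entry_mult\<close> below for the agreement with the matrix product.
\<close>

definition heisenberg :: "nat \<Rightarrow> heis monoid" where
  "heisenberg r =
    \<lparr>carrier = {0..<int r} \<times> {0..<int r} \<times> {0..<int r},
     monoid.mult = (\<lambda>(a1, a2, a3) (b1, b2, b3).
       ((a1 + b1) mod int r, (a2 + b2 + a1 * b3) mod int r, (a3 + b3) mod int r)),
     one = (0, 0, 0)\<rparr>"

fun heis_entry :: "heis \<Rightarrow> nat \<Rightarrow> nat \<Rightarrow> int" where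
  "heis_entry (a1, a2, a3) i j =
    (if i = j then 1
     else if i = 0 \<and> j = 1 then a1
     else if i = 0 \<and> j = 2 then a2
     else if i = 1 \<and> j = 2 then a3
     else 0)"

lemma heis_entry_mult:
  assumes "i < 3" "j < 3"
  shows "heis_entry (x \<otimes>\<^bsub>heisenberg r\<^esub> y) i j mod int r
       = (\<Sum>k<3. heis_entry x i k * heis_entry y k j) mod int r"
proof -
  obtain a1 a2 a3 where x: "x = (a1, a2, a3)" by (cases x)
  obtain b1 b2 b3 where y: "y = (b1, b2, b3)" by (cases y)
  have "i = 0 \<or> i = 1 \<or> i = 2" "j = 0 \<or> j = 1 \<or> j = 2" using assms by auto
  then show ?thesis
    by (elim disjE) (simp_all add: x y heisenberg_def numeral_3_eq_3 add_ac)
qed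

lemma group_heisenberg:
  assumes "r \<ge> 1"
  shows "group (heisenberg r)"
proof (rule groupI)
  fix x y z
  assume xyz: "x \<in> carrier (heisenberg r)" "y \<in> carrier (heisenberg r)"
    "z \<in> carrier (heisenberg r)"
  show "x \<otimes>\<^bsub>heisenberg r\<^esub> y \<otimes>\<^bsub>heisenberg r\<^esub> z = x \<otimes>\<^bsub>heisenberg r\<^esub> (y \<otimes>\<^bsub>heisenberg r\<^esub> z)"
  proof -
    obtain a1 a2 a3 where x: "x = (a1, a2, a3)" by (cases x)
    obtain b1 b2 b3 where y: "y = (b1, b2, b3)" by (cases y)
    obtain c1 c2 c3 where z: "z = (c1, c2, c3)" by (cases z)
    have "((a2 + b2 + a1 * b3) mod int r + c2 + (a1 + b1) mod int r * c3) mod int r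
        = ((a2 + b2 + a1 * b3) + c2 + (a1 + b1) * c3) mod int r"
      by (intro mod_add_cong mod_mult_cong) simp_all
    also have "\<dots> = (a2 + (b2 + c2 + b1 * c3) + a1 * (b3 + c3)) mod int r"
      by (simp add: algebra_simps)
    also have "\<dots> = (a2 + (b2 + c2 + b1 * c3) mod int r + a1 * ((b3 + c3) mod int r)) mod int r"
      by (intro mod_add_cong mod_mult_cong) simp_all
    finally show ?thesis
      by (simp add: x y z heisenberg_def mod_simps add.assoc)
  qed
next
  fix x
  assume x: "x \<in> carrier (heisenberg r)"
  obtain a1 a2 a3 where x_eq: "x = (a1, a2, a3)" by (cases x)
  have "((a1 * a3 - a2) mod int r + a2 + (- a1) mod int r * a3) mod int r
      = ((a1 * a3 - a2) + a2 + (- a1) * a3) mod int r"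
    by (intro mod_add_cong mod_mult_cong) simp_all
  then have "((- a1) mod int r, (a1 * a3 - a2) mod int r, (- a3) mod int r) \<otimes>\<^bsub>heisenberg r\<^esub> x
      = \<one>\<^bsub>heisenberg r\<^esub>"
    by (simp add: x_eq heisenberg_def mod_simps)
  moreover have "((- a1) mod int r, (a1 * a3 - a2) mod int r, (- a3) mod int r)
      \<in> carrier (heisenberg r)"
    using assms by (simp add: heisenberg_def)
  ultimately show "\<exists>y \<in> carrier (heisenberg r). y \<otimes>\<^bsub>heisenberg r\<^esub> x = \<one>\<^bsub>heisenberg r\<^esub>"
    by blast
qed (use assms in \<open>auto simp: heisenberg_def\<close>)

definition heis_reduce :: "nat \<Rightarrow> heis \<Rightarrow> heis" where
  "heis_reduce m = (\<lambda>(a1, a2, a3). (a1 mod int m, a2 mod int m, a3 mod int m))"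

lemma heis_reduce_hom:
  assumes "m \<ge> 1" "m dvd r"
  shows "heis_reduce m \<in> hom (heisenberg r) (heisenberg m)"
proof -
  have "(u + v + a * b) mod int m
      = (u mod int m + v mod int m + (a mod int m) * (b mod int m)) mod int m" for u v a b :: int
    by (intro mod_add_cong mod_mult_cong) simp_all
  then show ?thesis
    using assms
    by (auto simp: hom_def heis_reduce_def heisenberg_def mod_add_eq mod_mod_cancel)
qed

definition pseudocentralizer :: "nat \<Rightarrow> nat \<Rightarrow> heis set \<Rightarrow> heis set" where
  "pseudocentralizer p n S =
    {g \<in> carrier (heisenberg (p ^ n)). \<forall>s \<in> S.
       group_commutator (heisenberg (p ^ n)) s g
         \<in> kernel (heisenberg (p ^ n)) (heisenberg (p ^ (n - 1))) (heis_reduce (p ^ (n - 1)))}"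

section \<open>Valuations, special generating sets and injective sets\<close>

definition comp_val :: "nat \<Rightarrow> nat \<Rightarrow> int \<Rightarrow> nat" where
  "comp_val p n a = (if a = 0 then n else multiplicity (int p) a)"

fun val1 :: "nat \<Rightarrow> nat \<Rightarrow> heis \<Rightarrow> nat" where
  "val1 p n (a1, a2, a3) = comp_val p n a1"

fun val3 :: "nat \<Rightarrow> nat \<Rightarrow> heis \<Rightarrow> nat" where
  "val3 p n (a1, a2, a3) = comp_val p n a3"

definition nu :: "nat \<Rightarrow> nat \<Rightarrow> heis \<Rightarrow> nat" where
  "nu p n h = min (val1 p n h) (val3 p n h)"

text \<open>Only meaningful for finite non-empty \<open>A\<close>.\<close>

definition nu_set :: "nat \<Rightarrow> nat \<Rightarrow> heis set \<Rightarrow> nat" where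
  "nu_set p n A = Min (nu p n ` A)"

definition mu :: "nat \<Rightarrow> nat \<Rightarrow> heis \<Rightarrow> heis \<Rightarrow> int" where
  "mu p n s t =
    int (min (val3 p n s + val1 p n t) (val1 p n s + val3 p n t)) - int (nu_set p n {s, t})"

definition center_equiv :: "nat \<Rightarrow> nat \<Rightarrow> heis \<Rightarrow> heis \<Rightarrow> bool" where
  "center_equiv p n x y \<longleftrightarrow>
    x \<otimes>\<^bsub>heisenberg (p ^ n)\<^esub> inv\<^bsub>heisenberg (p ^ n)\<^esub> y \<in> group_center (heisenberg (p ^ n))"

definition noncentral :: "nat \<Rightarrow> nat \<Rightarrow> heis set \<Rightarrow> heis set" where
  "noncentral p n S = S - group_center (heisenberg (p ^ n))"

definition special_generating_set :: "nat \<Rightarrow> nat \<Rightarrow> heis set \<Rightarrow> heis set \<Rightarrow> bool" where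
  "special_generating_set p n H S \<longleftrightarrow>
    S \<subseteq> H \<and> generate (heisenberg (p ^ n)) S = H \<and>
    (noncentral p n S = {} \<or>
     (\<exists>h1 \<in> noncentral p n S.
        nu_set p n (noncentral p n S) = nu p n h1 \<and>
        (\<forall>h2 \<in> noncentral p n S - {h1}. \<forall>w::nat.
           \<not> center_equiv p n h2 (h1 [^]\<^bsub>heisenberg (p ^ n)\<^esub> w))))"

text \<open>
  The element \<open>h1\<close> is shared by the valuation condition and the minimality condition on \<open>mu\<close>,
  so both sit under one quantifier.  When \<open>noncentral p n S = {}\<close>, the set \<open>I\<close> is empty and
  both conditions are vacuous.
\<close>

definition injective_candidate :: "nat \<Rightarrow> nat \<Rightarrow> heis set \<Rightarrow> heis set \<Rightarrow> bool" where
  "injective_candidate p n S I \<longleftrightarrow>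
    I \<subseteq> noncentral p n S \<and> card I \<le> 2 \<and>
    (noncentral p n S \<noteq> {} \<longrightarrow>
     (\<exists>h1 \<in> I.
        nu_set p n I = nu_set p n (noncentral p n S) \<and>
        nu_set p n (noncentral p n S) = nu p n h1 \<and>
        (\<forall>h2. h2 \<noteq> h1 \<and> I = {h1, h2} \<longrightarrow>
           (\<forall>hj \<in> noncentral p n S - {h1}. mu p n h1 h2 \<le> mu p n h1 hj))))"

definition injective_set :: "nat \<Rightarrow> nat \<Rightarrow> heis set \<Rightarrow> heis set \<Rightarrow> bool" where
  "injective_set p n S I \<longleftrightarrow>
    injective_candidate p n S I \<and> (\<forall>J. injective_candidate p n S J \<longrightarrow> card J \<le> card I)"

end

theory Submission
  imports Defs "HOL-Number_Theory.Cong"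
begin

text \<open>
  Two elements commute up to the kernel of reduction modulo \<open>p ^ (n - 1)\<close> iff the determinant of
  their outer components is divisible by \<open>p ^ (n - 1)\<close>, so both \<open>P(H)\<close> and \<open>C(H)\<close> are
  annihilators with respect to this alternating form.  The distinguished generator is
  \<open>h\<^sub>1 = p ^ v u\<close> with \<open>u\<close> primitive; complete \<open>u\<close> to a basis \<open>u, u'\<close> of determinant 1.
  Let \<open>w \<le> n\<close> be maximal such that \<open>p ^ w\<close> divides the \<open>u'\<close>-coordinate of every generator.
  Since \<open>p ^ v\<close> divides all generators, \<open>x u + y u'\<close> annihilates \<open>H\<close> modulo \<open>p ^ k\<close> iff
  \<open>p ^ (k - v)\<close> divides \<open>y\<close> and \<open>p ^ (k - w)\<close> divides \<open>x\<close>.  Passing from \<open>k = n\<close> to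
  \<open>k = n - 1\<close> thus gains a factor \<open>p\<close> from \<open>y\<close>, and another one from \<open>x\<close> iff \<open>w < n\<close>, which
  for a special generating set means that there is a second noncentral generator.
\<close>

section \<open>Commutators, center and powers in the Heisenberg group\<close>

fun heis_det :: "heis \<Rightarrow> heis \<Rightarrow> int" where
  "heis_det (a1, a2, a3) (b1, b2, b3) = a1 * b3 - b1 * a3"

lemma heisenberg_mult:
  "(a1, a2, a3) \<otimes>\<^bsub>heisenberg r\<^esub> (b1, b2, b3) =
    ((a1 + b1) mod int r, (a2 + b2 + a1 * b3) mod int r, (a3 + b3) mod int r)"
  by (simp add: heisenberg_def)

lemma heisenberg_one: "\<one>\<^bsub>heisenberg r\<^esub> = (0, 0, 0)"
  by (simp add: heisenberg_def)

lemma heisenberg_carrier: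
  "carrier (heisenberg r) = {0..<int r} \<times> {0..<int r} \<times> {0..<int r}"
  by (simp add: heisenberg_def)

lemma heisenberg_inv:
  assumes "r \<ge> 1" "(a1, a2, a3) \<in> carrier (heisenberg r)"
  shows "inv\<^bsub>heisenberg r\<^esub> (a1, a2, a3) =
    ((- a1) mod int r, (a1 * a3 - a2) mod int r, (- a3) mod int r)"
proof -
  interpret group "heisenberg r" using assms(1) by (rule group_heisenberg)
  have "((a1 * a3 - a2) mod int r + a2 + (- a1) mod int r * a3) mod int r
      = ((a1 * a3 - a2) + a2 + (- a1) * a3) mod int r"
    by (intro mod_add_cong mod_mult_cong) simp_all
  then show ?thesis
    using assms by (intro inv_equality) (auto simp: heisenberg_def mod_simps)
qed

lemma heisenberg_commutator:
  assumes "r \<ge> 1" "x \<in> carrier (heisenberg r)" "y \<in> carrier (heisenberg r)"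
  shows "group_commutator (heisenberg r) x y = (0, heis_det x y mod int r, 0)"
proof -
  obtain a1 a2 a3 where x: "x = (a1, a2, a3)" by (cases x)
  obtain b1 b2 b3 where y: "y = (b1, b2, b3)" by (cases y)
  let ?R = "int r"
  \<comment> \<open>Facts \<open>1\<close> to \<open>4\<close> remove the inner reductions in the
    order in which the four factors are multiplied from left to right, so that rewriting collapses
    the middle component.\<close>
  have 1: "((- a1) mod ?R + (- b1) mod ?R) mod ?R = (- a1 - b1) mod ?R"
    by (simp add: mod_simps)
  have 2: "((a1 * a3 - a2) mod ?R + (b1 * b3 - b2) mod ?R + (- a1) mod ?R * ((- b3) mod ?R)) mod ?R
      = ((a1 * a3 - a2) + (b1 * b3 - b2) + (- a1) * (- b3)) mod ?R"
    by (intro mod_add_cong mod_mult_cong) simp_all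
  have 3: "(((a1 * a3 - a2) + (b1 * b3 - b2) + (- a1) * (- b3)) mod ?R + a2
        + (- a1 - b1) mod ?R * a3) mod ?R
      = (((a1 * a3 - a2) + (b1 * b3 - b2) + (- a1) * (- b3)) + a2 + (- a1 - b1) * a3) mod ?R"
    by (intro mod_add_cong mod_mult_cong) simp_all
  have 4: "((((a1 * a3 - a2) + (b1 * b3 - b2) + (- a1) * (- b3)) + a2 + (- a1 - b1) * a3) mod ?R
        + b2 + ((- a1 - b1) mod ?R + a1) mod ?R * b3) mod ?R
      = ((((a1 * a3 - a2) + (b1 * b3 - b2) + (- a1) * (- b3)) + a2 + (- a1 - b1) * a3)
        + b2 + (- a1 - b1 + a1) * b3) mod ?R"
    by (intro mod_add_cong mod_mult_cong) (simp_all add: mod_simps)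
  have "(((a1 * a3 - a2) + (b1 * b3 - b2) + (- a1) * (- b3)) + a2 + (- a1 - b1) * a3)
        + b2 + (- a1 - b1 + a1) * b3 = heis_det x y"
    by (simp add: x y algebra_simps)
  moreover have "(((- a1 - b1) mod ?R + a1) mod ?R + b1) mod ?R = 0"
      "((((- a3) mod ?R + (- b3) mod ?R) mod ?R + a3) mod ?R + b3) mod ?R = 0"
    by (simp_all add: mod_simps)
  ultimately show ?thesis
    using assms unfolding group_commutator_def x y
    by (simp only: heisenberg_inv heisenberg_mult 1 2 3 4)
qed

lemma heisenberg_commute_iff:
  assumes "x \<in> carrier (heisenberg r)" "y \<in> carrier (heisenberg r)"
  shows "x \<otimes>\<^bsub>heisenberg r\<^esub> y = y \<otimes>\<^bsub>heisenberg r\<^esub> x \<longleftrightarrow> int r dvd heis_det x y"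
proof -
  obtain a1 a2 a3 where x: "x = (a1, a2, a3)" by (cases x)
  obtain b1 b2 b3 where y: "y = (b1, b2, b3)" by (cases y)
  have "(a2 + b2 + a1 * b3) - (b2 + a2 + b1 * a3) = heis_det x y"
    by (simp add: x y)
  then have "(a2 + b2 + a1 * b3) mod int r = (b2 + a2 + b1 * a3) mod int r
      \<longleftrightarrow> int r dvd heis_det x y"
    by (metis mod_eq_dvd_iff)
  then show ?thesis
    by (simp add: x y heisenberg_mult add.commute)
qed

lemma heisenberg_center:
  assumes "r \<ge> 1"
  shows "group_center (heisenberg r) = {0} \<times> {0..<int r} \<times> {0}"
proof (cases "r = 1")
  case True
  then show ?thesis
    by (auto simp: group_center_def heisenberg_def)
next
  case False
  then have r: "r > 1" using assms by simp
  have "a1 = 0 \<and> a3 = 0" if "(a1, a2, a3) \<in> group_center (heisenberg r)" for a1 a2 a3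
  proof -
    have mem: "(a1, a2, a3) \<in> carrier (heisenberg r)"
      using that by (simp add: group_center_def)
    \<comment> \<open>Pairing with these two matrices isolates \<open>a1\<close> and
      \<open>- a3\<close>. They lie in the carrier only for \<open>r > 1\<close>, hence the separate
      case \<open>r = 1\<close>.\<close>
    have "int r dvd heis_det (a1, a2, a3) (0, 0, 1)" "int r dvd heis_det (a1, a2, a3) (1, 0, 0)"
      using that r by (subst heisenberg_commute_iff[symmetric];
          auto simp: group_center_def heisenberg_carrier)+
    then show ?thesis
      using mem by (auto simp: heisenberg_carrier dest: zdvd_imp_le)
  qed
  moreover have "(0, c, 0) \<in> group_center (heisenberg r)" if "c \<in> {0..<int r}" for c
    using that r by (auto simp: group_center_def heisenberg_def add.commute)
  ultimately show ?thesis
    by (auto simp: group_center_def heisenberg_carrier)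
qed

text \<open>Powers act linearly on the outer components. The middle one acquires a quadratic term,
  left unspecified because powers are compared only modulo the center.\<close>

lemma heisenberg_pow:
  assumes "r \<ge> 1"
  shows "\<exists>c. (a1, a2, a3) [^]\<^bsub>heisenberg r\<^esub> (w::nat) = ((int w * a1) mod int r, c, (int w * a3) mod int r)"
proof (induction w)
  case 0
  then show ?case by (simp add: heisenberg_one)
next
  case (Suc w)
  then obtain c where "(a1, a2, a3) [^]\<^bsub>heisenberg r\<^esub> w = ((int w * a1) mod int r, c, (int w * a3) mod int r)"
    by blast
  then show ?case
    by (simp add: heisenberg_mult mod_simps algebra_simps)
qed

lemma center_equiv_powI:
  assumes r: "p ^ n \<ge> 1"
    and "(a1, a2, a3) \<in> carrier (heisenberg (p ^ n))"
    and "(s1, s2, s3) \<in> carrier (heisenberg (p ^ n))"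
    and "[s1 = int w * a1] (mod int (p ^ n))" "[s3 = int w * a3] (mod int (p ^ n))"
  shows "center_equiv p n (s1, s2, s3) ((a1, a2, a3) [^]\<^bsub>heisenberg (p ^ n)\<^esub> w)"
proof -
  let ?R = "int (p ^ n)"
  interpret group "heisenberg (p ^ n)" using r by (rule group_heisenberg)
  obtain c where c: "(a1, a2, a3) [^]\<^bsub>heisenberg (p ^ n)\<^esub> w = ((int w * a1) mod ?R, c, (int w * a3) mod ?R)"
    using heisenberg_pow[OF r] by blast
  have eq: "(int w * a1) mod ?R = s1" "(int w * a3) mod ?R = s3"
    using assms(3-5) by (auto simp: cong_def heisenberg_carrier)
  have mem: "(s1, c, s3) \<in> carrier (heisenberg (p ^ n))"
    using nat_pow_closed[OF assms(2), of w] by (simp only: c eq)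
  have R_pos: "0 < int p ^ n"
    using r by (metis of_nat_0_less_iff of_nat_power less_eq_Suc_le One_nat_def)
  show ?thesis
    unfolding center_equiv_def c eq heisenberg_inv[OF r mem] heisenberg_center[OF r] heisenberg_mult
    using R_pos by (simp add: mod_simps)
qed

text \<open>Because \<open>d\<close> divides \<open>r\<close>, pairing with a fixed \<open>g\<close>
  is a homomorphism into the integers modulo \<open>d\<close>; its kernel is a subgroup, so checking
  generators is enough.\<close>

lemma dvd_heis_det_generate:
  assumes r: "r \<ge> 1" and "S \<subseteq> carrier (heisenberg r)" and d: "d dvd int r"
    and S: "\<And>s. s \<in> S \<Longrightarrow> d dvd heis_det s g"
    and h: "h \<in> generate (heisenberg r) S"
  shows "d dvd heis_det h g"
proof -
  interpret group "heisenberg r" using r by (rule group_heisenberg)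
  obtain g1 g2 g3 where g: "g = (g1, g2, g3)" by (cases g)
  have cong: "[x mod int r = x] (mod d)" for x
    using d by (simp add: cong_def mod_mod_cancel)
  have neg: "d dvd heis_det (inv\<^bsub>heisenberg r\<^esub> h) g" if "h \<in> S" for h
  proof -
    obtain h1 h2 h3 where h: "h = (h1, h2, h3)" by (cases h)
    have "[((- h1) mod int r) * g3 - g1 * ((- h3) mod int r) = (- h1) * g3 - g1 * (- h3)] (mod d)"
      by (intro cong_diff cong_mult cong cong_refl)
    moreover have "d dvd (- h1) * g3 - g1 * (- h3)"
      using S[OF that] dvd_minus_iff[of d "heis_det h g"] by (simp add: h g algebra_simps)
    ultimately have "d dvd ((- h1) mod int r) * g3 - g1 * ((- h3) mod int r)"
      using cong_dvd_iff by blast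
    then show ?thesis
      using that assms(2) r by (simp add: h g heisenberg_inv subset_iff)
  qed
  have add: "d dvd heis_det (x \<otimes>\<^bsub>heisenberg r\<^esub> y) g" if xy: "d dvd heis_det x g" "d dvd heis_det y g" for x y
  proof -
    obtain x1 x2 x3 where x: "x = (x1, x2, x3)" by (cases x)
    obtain y1 y2 y3 where y: "y = (y1, y2, y3)" by (cases y)
    have "[((x1 + y1) mod int r) * g3 - g1 * ((x3 + y3) mod int r) = (x1 + y1) * g3 - g1 * (x3 + y3)] (mod d)"
      by (intro cong_diff cong_mult cong cong_refl)
    moreover have "d dvd (x1 + y1) * g3 - g1 * (x3 + y3)"
      using dvd_add[OF xy] by (simp add: x y g algebra_simps)
    ultimately have "d dvd ((x1 + y1) mod int r) * g3 - g1 * ((x3 + y3) mod int r)"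
      using cong_dvd_iff by blast
    then show ?thesis
      by (simp add: x y g heisenberg_mult)
  qed
  show ?thesis
    using h
  proof (induction rule: generate.induct)
    case one
    then show ?case by (simp add: heisenberg_one g)
  qed (use S neg add in auto)
qed

section \<open>Annihilators of the commutator form\<close>

text \<open>The exponent \<open>k\<close> is kept apart from \<open>n\<close> so that one formula
  counts both the centralizer (\<open>k = n\<close>) and the pseudocentralizer
  (\<open>k = n - 1\<close>).\<close>

definition heis_perp :: "nat \<Rightarrow> nat \<Rightarrow> nat \<Rightarrow> heis set \<Rightarrow> heis set" where
  "heis_perp p n k H = {g \<in> carrier (heisenberg (p ^ n)). \<forall>s \<in> H. int p ^ k dvd heis_det s g}"

lemma centralizer_eq_heis_perp:
  assumes "H \<subseteq> carrier (heisenberg (p ^ n))"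
  shows "group_centralizer (heisenberg (p ^ n)) H = heis_perp p n n H"
proof -
  have "s \<otimes>\<^bsub>heisenberg (p ^ n)\<^esub> g = g \<otimes>\<^bsub>heisenberg (p ^ n)\<^esub> s \<longleftrightarrow> int p ^ n dvd heis_det s g"
    if "s \<in> H" "g \<in> carrier (heisenberg (p ^ n))" for s g
    using heisenberg_commute_iff[of s "p ^ n" g] assms that by (simp add: subsetD)
  then show ?thesis
    unfolding group_centralizer_def heis_perp_def by blast
qed

lemma pseudocentralizer_eq_heis_perp:
  assumes "p > 0" "H \<subseteq> carrier (heisenberg (p ^ n))"
  shows "pseudocentralizer p n H = heis_perp p n (n - 1) H"
proof -
  have r: "p ^ n \<ge> 1" using assms(1) by simp
  have "group_commutator (heisenberg (p ^ n)) s g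
         \<in> kernel (heisenberg (p ^ n)) (heisenberg (p ^ (n - 1))) (heis_reduce (p ^ (n - 1)))
       \<longleftrightarrow> int p ^ (n - 1) dvd heis_det s g"
    if "s \<in> H" "g \<in> carrier (heisenberg (p ^ n))" for s g
  proof -
    have comm: "group_commutator (heisenberg (p ^ n)) s g = (0, heis_det s g mod int p ^ n, 0)"
      using heisenberg_commutator[OF r subsetD[OF assms(2) that(1)] that(2)] by simp
    have mem: "(0, heis_det s g mod int p ^ n, 0) \<in> carrier (heisenberg (p ^ n))"
      using assms(1) by (simp add: heisenberg_carrier)
    have "heis_det s g mod int p ^ n mod int p ^ (n - 1) = heis_det s g mod int p ^ (n - 1)"
      by (simp add: mod_mod_cancel le_imp_power_dvd)
    then have "heis_reduce (p ^ (n - 1)) (0, heis_det s g mod int p ^ n, 0)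
        = (0, heis_det s g mod int p ^ (n - 1), 0)"
      by (simp add: heis_reduce_def)
    then show ?thesis
      using mem unfolding comm kernel_def heisenberg_one dvd_eq_mod_eq_0 by simp
  qed
  then show ?thesis
    unfolding pseudocentralizer_def heis_perp_def by blast
qed

text \<open>Linearity reduces the condition to generators, and central ones impose nothing since
  their outer components vanish.\<close>

lemma heis_perp_generate:
  assumes "p > 0" "S \<subseteq> carrier (heisenberg (p ^ n))" "k \<le> n"
  shows "heis_perp p n k (generate (heisenberg (p ^ n)) S) = heis_perp p n k (noncentral p n S)"
proof -
  have r: "p ^ n \<ge> 1" using assms(1) by simp
  have "int p ^ k dvd heis_det s g" if "s \<in> S" "\<forall>s\<in>noncentral p n S. int p ^ k dvd heis_det s g" for s g
  proof (cases "s \<in> noncentral p n S")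
    case False
    then have "s \<in> {0} \<times> {0..<int (p ^ n)} \<times> {0}"
      using that(1) heisenberg_center[OF r] by (simp add: noncentral_def)
    then show ?thesis by (cases g) auto
  qed (use that in auto)
  moreover have "int p ^ k dvd int (p ^ n)"
    using assms(3) by (simp add: le_imp_power_dvd)
  ultimately have "int p ^ k dvd heis_det h g"
    if "\<forall>s\<in>noncentral p n S. int p ^ k dvd heis_det s g" "h \<in> generate (heisenberg (p ^ n)) S" for h g
    using dvd_heis_det_generate[OF r assms(2)] that by blast
  moreover have "noncentral p n S \<subseteq> generate (heisenberg (p ^ n)) S"
    by (auto simp: noncentral_def intro: generate.incl)
  ultimately show ?thesis
    unfolding heis_perp_def by blast
qed

section \<open>Valuations and divisibility\<close>

text \<open>The bound \<open>k <= n\<close> reconciles the convention that 0 has valuation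
  \<open>n\<close> with the fact that every power of \<open>p\<close> divides 0.\<close>

lemma comp_val_ge_iff:
  assumes "prime p" "a \<in> {0..<int p ^ n}" "k \<le> n"
  shows "k \<le> comp_val p n a \<longleftrightarrow> int p ^ k dvd a"
proof -
  have "\<not> is_unit (int p)" using prime_gt_1_nat[OF assms(1)] by simp
  then show ?thesis
    using assms(3) by (auto simp: comp_val_def power_dvd_iff_le_multiplicity)
qed

lemma nu_ge_iff:
  assumes "prime p" "(a1, a2, a3) \<in> carrier (heisenberg (p ^ n))" "k \<le> n"
  shows "k \<le> nu p n (a1, a2, a3) \<longleftrightarrow> int p ^ k dvd a1 \<and> int p ^ k dvd a3"
  using assms by (simp add: nu_def comp_val_ge_iff heisenberg_carrier)

lemma nu_less_if_noncentral:
  assumes "prime p" "h \<in> carrier (heisenberg (p ^ n))" "h \<notin> group_center (heisenberg (p ^ n))"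
  shows "nu p n h < n"
proof (rule ccontr)
  assume "\<not> nu p n h < n"
  moreover obtain a1 a2 a3 where h: "h = (a1, a2, a3)" by (cases h)
  ultimately have "int p ^ n dvd a1" "int p ^ n dvd a3"
    using nu_ge_iff[OF assms(1), of a1 a2 a3 n n] assms(2) by auto
  then have "a1 = 0" "a3 = 0"
    using assms(2) by (auto simp: h heisenberg_carrier dest: zdvd_imp_le)
  then show False
    using assms h prime_gt_0_nat[OF assms(1)] heisenberg_center[of "p ^ n"] by (auto simp: heisenberg_carrier)
qed

section \<open>Counting in unimodular coordinates modulo \<open>p ^ n\<close>\<close>

lemma card_multiples_prime_power:
  assumes "p > 0" "j \<le> n"
  shows "card {x \<in> {0..<int p ^ n}. int p ^ j dvd x} = p ^ (n - j)"
proof -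
  have split: "int p ^ n = int p ^ j * int p ^ (n - j)"
    using assms(2) by (simp flip: power_add)
  have "{x \<in> {0..<int p ^ n}. int p ^ j dvd x} = (\<lambda>i. int p ^ j * i) ` {0..<int p ^ (n - j)}"
  proof (intro equalityI subsetI)
    fix x assume x: "x \<in> {x \<in> {0..<int p ^ n}. int p ^ j dvd x}"
    then obtain i where i: "x = int p ^ j * i" by (auto elim: dvdE)
    have pos: "0 < int p ^ j" using assms(1) by simp
    have "0 \<le> i" "i < int p ^ (n - j)"
      using x mult_less_cancel_left_pos[OF pos] zero_le_mult_iff[of "int p ^ j" i] pos
      unfolding i split by (force, simp del: zero_less_power)
    then show "x \<in> (\<lambda>i. int p ^ j * i) ` {0..<int p ^ (n - j)}"
      using i by auto
  qed (use assms(1) in \<open>auto simp: split\<close>)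
  moreover have "inj_on (\<lambda>i. int p ^ j * i) {0..<int p ^ (n - j)}"
    using assms(1) by (auto simp: inj_on_def)
  ultimately show ?thesis
    by (simp add: card_image nat_power_eq)
qed

text \<open>One entry is a unit modulo \<open>p ^ n\<close>, and its inverse supplies the second
  vector. The determinant is 1 only as a congruence, since \<open>u1\<close> and \<open>u3\<close>
  may share a factor prime to \<open>p\<close>.\<close>

lemma unimodular_completion:
  assumes "prime p" "\<not> (int p dvd u1 \<and> int p dvd u3)"
  shows "\<exists>u1' u3'. [u1 * u3' - u1' * u3 = 1] (mod int p ^ n)"
proof -
  have "coprime u (int p ^ n)" if "\<not> int p dvd u" for u
    using that assms(1) prime_imp_coprime[of "int p" u] by (simp add: coprime_commute)
  then consider "coprime u1 (int p ^ n)" | "coprime u3 (int p ^ n)"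
    using assms(2) by blast
  then show ?thesis
  proof cases
    case 1
    then obtain x where "[u1 * x = 1] (mod int p ^ n)"
      using cong_solve_coprime_int by blast
    then have "[u1 * x - 0 * u3 = 1] (mod int p ^ n)" by simp
    then show ?thesis by blast
  next
    case 2
    then obtain x where "[u3 * x = 1] (mod int p ^ n)"
      using cong_solve_coprime_int by blast
    then have "[u1 * 0 - (- x) * u3 = 1] (mod int p ^ n)" by (simp add: mult.commute)
    then show ?thesis by blast
  qed
qed

text \<open>Cramer's rule: multiply the vector by the determinant, which is congruent to 1, and
  expand.\<close>

lemma unimodular_coordinates:
  fixes u1 u3 u1' u3' x z N :: int
  assumes "[u1 * u3' - u1' * u3 = 1] (mod N)"
  shows "[x = (x * u3' - u1' * z) * u1 + (u1 * z - x * u3) * u1'] (mod N)"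
    and "[z = (x * u3' - u1' * z) * u3 + (u1 * z - x * u3) * u3'] (mod N)"
proof -
  have "[g = (u1 * u3' - u1' * u3) * g] (mod N)" for g
    using cong_scalar_right[OF assms, of g] by (simp add: cong_sym_eq)
  from this[of x] this[of z] show
    "[x = (x * u3' - u1' * z) * u1 + (u1 * z - x * u3) * u1'] (mod N)"
    "[z = (x * u3' - u1' * z) * u3 + (u1 * z - x * u3) * u3'] (mod N)"
    by (simp_all add: algebra_simps)
qed

text \<open>Passing to basis coordinates permutes the carrier. The two divisibility conditions then
  concern separate coordinates, and the middle component stays free.\<close>

lemma card_dvd_unimodular_coordinates:
  assumes "p > 0" "i \<le> n" "j \<le> n"
    and det: "[u1 * u3' - u1' * u3 = 1] (mod int p ^ n)"
  shows "card {(g1, g2, g3) \<in> carrier (heisenberg (p ^ n)).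
      int p ^ i dvd g1 * u3' - u1' * g3 \<and> int p ^ j dvd u1 * g3 - g1 * u3}
    = p ^ (n - i) * p ^ n * p ^ (n - j)"
    (is "card ?K = _")
proof -
  let ?N = "int p ^ n"
  let ?G = "{0..<?N} \<times> {0..<?N} \<times> {0..<?N}"
  define F where "F = (\<lambda>(g1, g2::int, g3). ((g1 * u3' - u1' * g3) mod ?N, g2, (u1 * g3 - g1 * u3) mod ?N))"
  have N: "?N > 0" using assms(1) by simp
  have inj: "inj_on F ?G"
  proof (rule inj_onI)
    fix g h assume gh: "g \<in> ?G" "h \<in> ?G" "F g = F h"
    obtain g1 g2 g3 where g: "g = (g1, g2, g3)" by (cases g)
    obtain h1 h2 h3 where h: "h = (h1, h2, h3)" by (cases h)
    have x: "[g1 * u3' - u1' * g3 = h1 * u3' - u1' * h3] (mod ?N)"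
      and y: "[u1 * g3 - g1 * u3 = u1 * h3 - h1 * u3] (mod ?N)" and "g2 = h2"
      using gh(3) by (auto simp: g h F_def cong_def)
    have "[g1 = h1] (mod ?N)" "[g3 = h3] (mod ?N)"
      using unimodular_coordinates[OF det, where x = g1 and z = g3] unimodular_coordinates[OF det, where x = h1 and z = h3]
        cong_add[OF cong_scalar_right[OF x] cong_scalar_right[OF y]]
      by (meson cong_sym cong_trans)+
    then show "g = h"
      using gh(1,2) \<open>g2 = h2\<close> by (auto simp: g h cong_def)
  qed
  have "F ` ?G \<subseteq> ?G"
    using N by (auto simp: F_def)
  \<comment> \<open>An injective self-map of a finite set is onto, so no inverse has to be written
    down.\<close>
  with inj have surj: "F ` ?G = ?G"
    by (intro endo_inj_surj) auto
  have dvd: "int p ^ k dvd x mod ?N \<longleftrightarrow> int p ^ k dvd x" if "k \<le> n" for k x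
    using that by (simp add: dvd_mod_iff le_imp_power_dvd)
  let ?X = "\<lambda>k. {x \<in> {0..<?N}. int p ^ k dvd x}"
  have image: "F ` ?K = ?X i \<times> {0..<?N} \<times> ?X j"
  proof
    show "F ` ?K \<subseteq> ?X i \<times> {0..<?N} \<times> ?X j"
      using N assms(2,3) by (auto simp: F_def heisenberg_carrier dvd)
    show "?X i \<times> {0..<?N} \<times> ?X j \<subseteq> F ` ?K"
    proof
      fix z assume z: "z \<in> ?X i \<times> {0..<?N} \<times> ?X j"
      then have "z \<in> F ` ?G" unfolding surj by auto
      then obtain g where g: "g \<in> ?G" "z = F g" by blast
      then have "g \<in> ?K"
        using z assms(2,3) by (auto simp: F_def heisenberg_carrier dvd)
      then show "z \<in> F ` ?K" using g by blast
    qed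
  qed
  have "inj_on F ?K"
    by (rule inj_on_subset[OF inj]) (auto simp: heisenberg_carrier)
  from card_image[OF this] have "card ?K = card (?X i \<times> {0..<?N} \<times> ?X j)"
    unfolding image by (rule sym)
  then show ?thesis
    unfolding card_cartesian_product card_multiples_prime_power[OF assms(1,2)]
      card_multiples_prime_power[OF assms(1,3)] by (simp add: nat_power_eq)
qed

text \<open>The element \<open>p ^ v * u\<close> of \<open>T\<close> forces the condition on the
  \<open>u'\<close>-coordinate of \<open>g\<close>. This disposes of one of the two terms of every
  pairing, and an element of \<open>T\<close> at which \<open>w\<close> is attained then forces the
  condition on the \<open>u\<close>-coordinate.\<close>

lemma heis_perp_coordinates:
  assumes p: "prime p" and T: "T \<subseteq> carrier (heisenberg (p ^ n))" and "k \<le> n" "v \<le> k"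
    and det: "[u1 * u3' - u1' * u3 = 1] (mod int p ^ n)"
    and a: "(int p ^ v * u1, a2, int p ^ v * u3) \<in> T"
    and v: "\<And>s1 s2 s3. (s1, s2, s3) \<in> T \<Longrightarrow> int p ^ v dvd s1 \<and> int p ^ v dvd s3"
    and w: "\<And>s1 s2 s3. (s1, s2, s3) \<in> T \<Longrightarrow> int p ^ w dvd u1 * s3 - s1 * u3"
    and b: "w < n \<Longrightarrow> \<exists>(s1, s2, s3) \<in> T. \<not> int p ^ Suc w dvd u1 * s3 - s1 * u3"
  shows "heis_perp p n k T = {(g1, g2, g3) \<in> carrier (heisenberg (p ^ n)).
      int p ^ (k - w) dvd g1 * u3' - u1' * g3 \<and> int p ^ (k - v) dvd u1 * g3 - g1 * u3}"
proof -
  have p0: "int p \<noteq> 0" using p by auto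
  \<comment> \<open>The determinant of the basis times that of \<open>s, g\<close> equals the
    determinant of their coordinates; the first factor is 1 modulo \<open>p ^ n\<close>, hence
    modulo \<open>p ^ k\<close>.\<close>
  have pluecker: "int p ^ k dvd s1 * g3 - g1 * s3 \<longleftrightarrow>
      int p ^ k dvd (s1 * u3' - u1' * s3) * (u1 * g3 - g1 * u3)
        - (u1 * s3 - s1 * u3) * (g1 * u3' - u1' * g3)" for s1 s3 g1 g3
  proof -
    have "[(u1 * u3' - u1' * u3) * (s1 * g3 - g1 * s3) = 1 * (s1 * g3 - g1 * s3)] (mod int p ^ n)"
      by (rule cong_scalar_right[OF det])
    then have "[(s1 * u3' - u1' * s3) * (u1 * g3 - g1 * u3)
        - (u1 * s3 - s1 * u3) * (g1 * u3' - u1' * g3) = s1 * g3 - g1 * s3] (mod int p ^ n)"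
      by (simp add: algebra_simps)
    then have "[(s1 * u3' - u1' * s3) * (u1 * g3 - g1 * u3)
        - (u1 * s3 - s1 * u3) * (g1 * u3' - u1' * g3) = s1 * g3 - g1 * s3] (mod int p ^ k)"
      using \<open>k \<le> n\<close> by (meson cong_dvd_modulus le_imp_power_dvd)
    then show ?thesis by (simp add: cong_dvd_iff)
  qed
  \<comment> \<open>This also covers \<open>i > k\<close>: the truncated difference is then 0, and
    \<open>x\<close> alone supplies \<open>p ^ k\<close>.\<close>
  have dvd_mult: "int p ^ k dvd x * y" if "int p ^ i dvd x" "int p ^ (k - i) dvd y" for i x y
  proof -
    have "int p ^ k dvd int p ^ i * int p ^ (k - i)"
      by (simp add: le_imp_power_dvd flip: power_add)
    then show ?thesis using mult_dvd_mono[OF that] dvd_trans by blast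
  qed
  have alpha: "int p ^ v dvd s1 * u3' - u1' * s3" if "(s1, s2, s3) \<in> T" for s1 s2 s3
    using v[OF that] by auto
  have "(\<forall>s \<in> T. int p ^ k dvd heis_det s (g1, g2, g3)) \<longleftrightarrow>
      int p ^ (k - w) dvd g1 * u3' - u1' * g3 \<and> int p ^ (k - v) dvd u1 * g3 - g1 * u3"
    (is "?L \<longleftrightarrow> ?R") for g1 g2 g3
  proof
    assume ?R
    show ?L
    proof
      fix s assume s: "s \<in> T"
      obtain s1 s2 s3 where s_eq: "s = (s1, s2, s3)" by (cases s)
      show "int p ^ k dvd heis_det s (g1, g2, g3)"
        using \<open>?R\<close> dvd_diff[OF dvd_mult[OF alpha] dvd_mult[OF w]] s
        unfolding s_eq heis_det.simps pluecker[of s1 g3 g1 s3] by blast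
    qed
  next
    assume L: ?L
    have "int p ^ k = int p ^ v * int p ^ (k - v)"
      using \<open>v \<le> k\<close> by (simp flip: power_add)
    \<comment> \<open>The pairing of \<open>p ^ v * u\<close> with \<open>g\<close> is exactly
      \<open>p ^ v\<close> times the \<open>u'\<close>-coordinate of \<open>g\<close>.\<close>
    moreover have "int p ^ k dvd int p ^ v * (u1 * g3 - g1 * u3)"
      using L a by (fastforce simp: algebra_simps)
    ultimately have y: "int p ^ (k - v) dvd u1 * g3 - g1 * u3"
      using p0 by simp
    have x: "int p ^ k dvd (u1 * s3 - s1 * u3) * (g1 * u3' - u1' * g3)" if s: "(s1, s2, s3) \<in> T" for s1 s2 s3
    proof -
      have "int p ^ k dvd (s1 * u3' - u1' * s3) * (u1 * g3 - g1 * u3)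
        - (u1 * s3 - s1 * u3) * (g1 * u3' - u1' * g3)"
        using bspec[OF L s] unfolding heis_det.simps by (rule iffD1[OF pluecker])
      moreover have "int p ^ k dvd (s1 * u3' - u1' * s3) * (u1 * g3 - g1 * u3)"
        using dvd_mult[OF alpha[OF s] y] .
      ultimately show ?thesis
        by (metis dvd_diff_right_iff)
    qed
    have "int p ^ (k - w) dvd g1 * u3' - u1' * g3"
    \<comment> \<open>For \<open>w < k\<close> some element of \<open>T\<close> has
      \<open>u'\<close>-coordinate \<open>p ^ w * c\<close> with \<open>c\<close> prime to
      \<open>p\<close>, and \<open>c\<close> can be cancelled. Otherwise \<open>k - w\<close> is
      0.\<close>
    proof (cases "w < k")
      case True
      then obtain s1 s2 s3 where s: "(s1, s2, s3) \<in> T" "\<not> int p ^ Suc w dvd u1 * s3 - s1 * u3"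
        using b \<open>k \<le> n\<close> by fastforce
      from w[OF s(1)] obtain c where c: "u1 * s3 - s1 * u3 = int p ^ w * c" by (elim dvdE)
      have "int p ^ k = int p ^ w * int p ^ (k - w)"
        using True by (simp flip: power_add)
      then have "int p ^ (k - w) dvd c * (g1 * u3' - u1' * g3)"
        using x[OF s(1)] p0 unfolding c by (simp add: mult.assoc)
      moreover have "\<not> int p dvd c"
        using s(2) p0 unfolding c by (simp add: mult.commute)
      then have "coprime (int p ^ (k - w)) c"
        using p prime_imp_coprime[of "int p" c] by simp
      ultimately show ?thesis
        by (simp add: coprime_dvd_mult_right_iff)
    qed simp
    then show ?R using y by simp
  qed
  then show ?thesis
    unfolding heis_perp_def by auto
qed

text \<open>The truncated subtractions in the count carry the result: lowering \<open>k\<close> from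
  \<open>n\<close> to \<open>n - 1\<close> raises \<open>n - (k - v)\<close> by one as
  \<open>v < n\<close>, but raises \<open>n - (k - w)\<close> only if \<open>w < n\<close>. The two
  facts about \<open>w = n\<close> link this to the number of generators.\<close>

lemma card_heis_perp:
  assumes p: "prime p" and T: "T \<subseteq> carrier (heisenberg (p ^ n))"
    and aT: "a \<in> T" and a: "a \<notin> group_center (heisenberg (p ^ n))"
    and min: "\<And>s. s \<in> T \<Longrightarrow> nu p n a \<le> nu p n s"
  obtains v w where "v < n" "w \<le> n" "T = {a} \<Longrightarrow> w = n"
    and "w = n \<Longrightarrow> \<forall>s \<in> T. \<exists>m::nat. center_equiv p n s (a [^]\<^bsub>heisenberg (p ^ n)\<^esub> m)"
    and "\<And>k. n - 1 \<le> k \<Longrightarrow> k \<le> n \<Longrightarrow>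
      card (heis_perp p n k T) = p ^ (n - (k - w)) * p ^ n * p ^ (n - (k - v))"
proof -
  define v where "v = nu p n a"
  have p0: "int p \<noteq> 0" and r: "p ^ n \<ge> 1" using p prime_gt_0_nat[OF p] by auto
  have vn: "v < n" using nu_less_if_noncentral[OF p _ a] aT T by (auto simp: v_def)
  obtain a1 a2 a3 where a_eq: "a = (a1, a2, a3)" by (cases a)
  have v_dvd: "int p ^ v dvd s1 \<and> int p ^ v dvd s3" if "(s1, s2, s3) \<in> T" for s1 s2 s3
    using nu_ge_iff[OF p, of s1 s2 s3 n v] min[OF that] T that vn by (auto simp: v_def)
  from v_dvd obtain u1 u3 where u: "a1 = int p ^ v * u1" "a3 = int p ^ v * u3"
    using aT a_eq by (meson dvdE)
  \<comment> \<open>Primitivity holds because \<open>v\<close> is the exact minimum valuation of the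
    outer components of \<open>a\<close>.\<close>
  have "\<not> (int p dvd u1 \<and> int p dvd u3)"
  proof
    assume "int p dvd u1 \<and> int p dvd u3"
    then have "int p ^ Suc v dvd a1 \<and> int p ^ Suc v dvd a3"
      using p0 by (simp add: u mult.commute)
    then have "Suc v \<le> nu p n a"
      using nu_ge_iff[OF p, of a1 a2 a3 n "Suc v"] aT T vn a_eq by auto
    then show False by (simp add: v_def)
  qed
  then obtain u1' u3' where det: "[u1 * u3' - u1' * u3 = 1] (mod int p ^ n)"
    using unimodular_completion[OF p] by blast
  \<comment> \<open>The cap \<open>w <= n\<close> ensures that a maximum exists: if
    \<open>T = {a}\<close>, all \<open>u'\<close>-coordinates are 0 and every power divides
    them.\<close>
  define Q where "Q w \<longleftrightarrow> w \<le> n \<and> (\<forall>(s1, s2, s3) \<in> T. int p ^ w dvd u1 * s3 - s1 * u3)" for w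
  have "Q 0" by (auto simp: Q_def)
  then obtain w where w: "Q w" "\<And>x. Q x \<Longrightarrow> x \<le> w"
    using Greatest_le_nat[of Q _ n] GreatestI_nat[of Q 0 n] by (auto simp: Q_def)
  have w_dvd: "int p ^ w dvd u1 * s3 - s1 * u3" if "(s1, s2, s3) \<in> T" for s1 s2 s3
    using w(1) that by (auto simp: Q_def)
  have w_max: "\<exists>(s1, s2, s3) \<in> T. \<not> int p ^ Suc w dvd u1 * s3 - s1 * u3" if "w < n"
    using w(2)[of "Suc w"] that by (fastforce simp: Q_def)
  show thesis
  proof
    show "v < n" by fact
    show wn: "w \<le> n" using w(1) by (simp add: Q_def)
    show "w = n" if "T = {a}"
    proof -
      have "Q n" using that by (auto simp: Q_def a_eq u algebra_simps)
      then show ?thesis using w(2)[of n] wn by simp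
    qed
    show "\<forall>s \<in> T. \<exists>m::nat. center_equiv p n s (a [^]\<^bsub>heisenberg (p ^ n)\<^esub> m)" if "w = n"
    proof
      fix s assume s: "s \<in> T"
      obtain s1 s2 s3 where s_eq: "s = (s1, s2, s3)" by (cases s)
      have "int p ^ v dvd s1 * u3' - u1' * s3"
        using v_dvd s unfolding s_eq by (intro dvd_diff) auto
      then obtain c where c: "s1 * u3' - u1' * s3 = int p ^ v * c" by (elim dvdE)
      \<comment> \<open>With \<open>w = n\<close> the \<open>u'\<close>-coordinate of
        \<open>s\<close> vanishes modulo \<open>p ^ n\<close>, so the outer part of \<open>s\<close>
        is \<open>c\<close> times that of \<open>a\<close>. Reducing \<open>c\<close> gives a
        natural exponent.\<close>
      define m where "m = nat (c mod int p ^ n)"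
      have m: "[c = int m] (mod int p ^ n)"
        using p0 by (simp add: m_def cong_def)
      have "[u1 * s3 - s1 * u3 = 0] (mod int p ^ n)"
        using w_dvd s that unfolding s_eq by (auto simp: cong_0_iff)
      then have "[c * (int p ^ v * x) + (u1 * s3 - s1 * u3) * y = int m * (int p ^ v * x) + 0 * y] (mod int p ^ n)" for x y
        by (intro cong_add cong_scalar_right m)
      from this[of u1 u1'] this[of u3 u3']
      have "[s1 = int m * a1] (mod int p ^ n)" "[s3 = int m * a3] (mod int p ^ n)"
        using unimodular_coordinates[OF det, where x = s1 and z = s3] unfolding c u
        by (auto simp: ac_simps elim: cong_trans)
      then show "\<exists>m::nat. center_equiv p n s (a [^]\<^bsub>heisenberg (p ^ n)\<^esub> m)"
        using center_equiv_powI[OF r, of a1 a2 a3 s1 s2 s3 m] T aT s unfolding s_eq a_eq by auto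
    qed
    show "card (heis_perp p n k T) = p ^ (n - (k - w)) * p ^ n * p ^ (n - (k - v))"
      if "n - 1 \<le> k" "k \<le> n" for k
    proof -
      have mem: "(int p ^ v * u1, a2, int p ^ v * u3) \<in> T"
        using aT by (simp add: a_eq u)
      have vk: "v \<le> k" using vn that by simp
      have "heis_perp p n k T = {(g1, g2, g3) \<in> carrier (heisenberg (p ^ n)).
          int p ^ (k - w) dvd g1 * u3' - u1' * g3 \<and> int p ^ (k - v) dvd u1 * g3 - g1 * u3}"
        by (rule heis_perp_coordinates[OF p T that(2) vk det mem]) (use v_dvd w_dvd w_max in blast)+
      then show ?thesis
        using card_dvd_unimodular_coordinates[OF prime_gt_0_nat[OF p] _ _ det, of "k - w" "k - v"] that(2)
        by simp
    qed
  qed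
qed

text \<open>Whenever two noncentral generators exist, a candidate pair does too: an element of least
  \<open>nu\<close> and a partner minimizing \<open>mu\<close> against it. Maximality then fixes the
  cardinality.\<close>

lemma card_injective_set:
  assumes fin: "finite (noncentral p n S)" and I: "injective_set p n S I"
  shows "card I = min 2 (card (noncentral p n S))"
proof -
  let ?T = "noncentral p n S"
  have cand: "injective_candidate p n S I" and max: "\<And>J. injective_candidate p n S J \<Longrightarrow> card J \<le> card I"
    using I by (auto simp: injective_set_def)
  have sub: "I \<subseteq> ?T" and le: "card I \<le> 2" and ne: "?T \<noteq> {} \<Longrightarrow> I \<noteq> {}"
    using cand by (auto simp: injective_candidate_def)
  have "card I \<le> card ?T" using card_mono[OF fin sub] .
  moreover have "card I \<ge> 2" if "card ?T \<ge> 2"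
  proof -
    have Tne: "?T \<noteq> {}" using that by auto
    then obtain a where a: "a \<in> ?T" "nu_set p n ?T = nu p n a"
      using cand by (auto simp: injective_candidate_def)
    have "?T - {a} \<noteq> {}"
      using that a(1) fin by (metis card_Diff_singleton card.empty diff_is_0_eq not_less_eq_eq numeral_2_eq_2 One_nat_def)
    then obtain b where b: "b \<in> ?T - {a}" "\<And>h. h \<in> ?T - {a} \<Longrightarrow> mu p n a b \<le> mu p n a h"
      using ex_min_if_finite[of "mu p n a ` (?T - {a})"] fin
      by (metis (no_types, lifting) arg_min_if_finite(1) arg_min_least finite_Diff)
    have "nu p n a \<le> nu p n b"
      using b(1) fin unfolding a(2)[symmetric] nu_set_def by (intro Min_le) auto
    then have "nu_set p n {a, b} = nu p n a"
      by (simp add: nu_set_def)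
    then have "injective_candidate p n S {a, b}"
      unfolding injective_candidate_def
    proof (intro conjI impI bexI[of _ a] allI ballI)
      show "{a, b} \<subseteq> ?T" "card {a, b} \<le> 2" "a \<in> {a, b}"
        using a(1) b(1) by (auto simp: card_insert_if)
      show "nu_set p n {a, b} = nu_set p n ?T" "nu_set p n ?T = nu p n a"
        using a(2) \<open>nu_set p n {a, b} = nu p n a\<close> by simp_all
      fix h hj assume "h \<noteq> a \<and> {a, b} = {a, h}" "hj \<in> ?T - {a}"
      then show "mu p n a h \<le> mu p n a hj"
        using b(2)[of hj] by (auto simp: doubleton_eq_iff)
    qed
    then show ?thesis using max[of "{a, b}"] b(1) by auto
  qed
  moreover have "card I \<ge> 1" if "card ?T \<ge> 1"
  proof -
    have "?T \<noteq> {}" using that by auto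
    then have "I \<noteq> {}" "finite I" using ne finite_subset[OF sub fin] by simp_all
    then show ?thesis by (simp add: Suc_leI card_gt_0_iff)
  qed
  ultimately show ?thesis using le by linarith
qed

section \<open>Comparison of the two cardinalities\<close>

theorem theorem5p45:
  fixes p n :: nat and H S I :: "heis set"
  assumes "prime p"
    and "n \<ge> 1"
    and "subgroup H (heisenberg (p ^ n))"
    and "special_generating_set p n H S"
    and "injective_set p n S I"
  shows "(card I = 0 \<longrightarrow>
            card (pseudocentralizer p n H) = card (group_centralizer (heisenberg (p ^ n)) H)) \<and>
         (card I = 1 \<longrightarrow>
            card (pseudocentralizer p n H) = p * card (group_centralizer (heisenberg (p ^ n)) H)) \<and>
         (card I = 2 \<longrightarrow>
            card (pseudocentralizer p n H) = p ^ 2 * card (group_centralizer (heisenberg (p ^ n)) H))"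
proof -
  let ?T = "noncentral p n S"
  have p0: "p > 0" using assms(1) by (rule prime_gt_0_nat)
  have H: "H \<subseteq> carrier (heisenberg (p ^ n))"
    using assms(3) by (rule subgroup.subset)
  have gen: "generate (heisenberg (p ^ n)) S = H" and S: "S \<subseteq> carrier (heisenberg (p ^ n))"
    using assms(4) H by (auto simp: special_generating_set_def)
  have T: "?T \<subseteq> carrier (heisenberg (p ^ n))"
    using S by (auto simp: noncentral_def)
  have fin: "finite ?T"
    using T by (rule finite_subset) (simp add: heisenberg_carrier)
  have PC: "pseudocentralizer p n H = heis_perp p n (n - 1) ?T"
    "group_centralizer (heisenberg (p ^ n)) H = heis_perp p n n ?T"
    using heis_perp_generate[OF p0 S] pseudocentralizer_eq_heis_perp[OF p0 H]
      centralizer_eq_heis_perp[OF H] by (simp_all add: gen)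
  have I: "card I = min 2 (card ?T)"
    using card_injective_set[OF fin assms(5)] .
  show ?thesis
  proof (cases "?T = {}")
    case True
    \<comment> \<open>Without noncentral generators both annihilators are the whole group.\<close>
    then show ?thesis by (simp add: PC I heis_perp_def)
  next
    case False
    then obtain a where a: "a \<in> ?T" "nu_set p n ?T = nu p n a"
      and special: "\<And>h w. h \<in> ?T - {a} \<Longrightarrow> \<not> center_equiv p n h (a [^]\<^bsub>heisenberg (p ^ n)\<^esub> (w::nat))"
      using assms(4) unfolding special_generating_set_def by blast
    have min: "nu p n a \<le> nu p n s" if "s \<in> ?T" for s
      unfolding a(2)[symmetric] nu_set_def using fin that by (intro Min_le) auto
    have "a \<notin> group_center (heisenberg (p ^ n))"
      using a(1) by (simp add: noncentral_def)
    from card_heis_perp[OF assms(1) T a(1) this min]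
    obtain v w where vw: "v < n" "w \<le> n" "?T = {a} \<Longrightarrow> w = n"
      "w = n \<Longrightarrow> \<forall>s \<in> ?T. \<exists>m::nat. center_equiv p n s (a [^]\<^bsub>heisenberg (p ^ n)\<^esub> m)"
      and K: "\<And>k. n - 1 \<le> k \<Longrightarrow> k \<le> n \<Longrightarrow>
        card (heis_perp p n k ?T) = p ^ (n - (k - w)) * p ^ n * p ^ (n - (k - v))"
      by blast
    have C: "card (heis_perp p n n ?T) = p ^ w * p ^ n * p ^ v"
      using K[of n] vw by simp
    have v': "n - (n - 1 - v) = Suc v" using vw(1) by linarith
    show ?thesis
    proof (cases "?T = {a}")
      case True
      \<comment> \<open>Here \<open>n - (n - 1 - w)\<close> is still \<open>n\<close>, so only the
        exponent involving \<open>v\<close> grows.\<close>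
      then have "card I = 1" "w = n" using I vw(3) by simp_all
      then show ?thesis
        using C K[of "n - 1"] v' by (simp add: PC)
    next
      case False
      then obtain b where b: "b \<in> ?T - {a}" using a(1) by blast
      \<comment> \<open>If \<open>w = n\<close>, then \<open>b\<close> would be a power of
        \<open>a\<close> modulo the center, contrary to specialness.\<close>
      then have "w < n" using vw(2,4) special by (metis DiffD1 le_neq_implies_less)
      then have w': "n - (n - 1 - w) = Suc w" by linarith
      have "card {a, b} \<le> card ?T"
        using a(1) b fin by (intro card_mono) auto
      then have "card I = 2" using I b by auto
      then show ?thesis
        using C K[of "n - 1"] v' w' by (simp add: PC power2_eq_square)
    qed
  qed
qed

end
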